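(* The transitive tournament $T_n$ on $n$ vertices satisfies $$b(T_n)\geq \frac{3n-5-\sqrt{7n^2-28n+25}}{2}>\frac{3-\sqrt{7}}{2}n+\sqrt{7}-\frac{5}{2}.$$ Therefore $\lim_{n\to\infty} b(T_n)/n\ge (3-\sqrt{7})/2\approx 0.177124$.
   Context: A bar is a horizontal line segment in the plane. A channel is a vertical strip of positive width. One bar sees another bar above it if there is an unblocked channel between them, i.e. a vertical strip of positive width meeting both bars such that no other bar meets the part of the strip between the two. A $t$-bar visibility representation of a digraph $G$ assigns each vertex at most $t$ bars in the plane so that, for distinct vertices $x,y$, there is an arc $xy$ (from $x$ to $y$) in $G$ if and only if some bar for $x$ sees some bar for $y$ above it via an unblocked channel. The bar visibility number $b(G)$ of a digraph $G$ is the least $t$ such that $G$ has a $t$-bar visibility representation. A tournament is an orientation of a complete graph; it is transitive if $xz$ is an arc whenever $xy$ and $yz$ are arcs. Up to isomorphism there is only one transitive tournament on $n$ vertices, denoted $T_n$: its vertices can be indexed $v_1,\ldots,v_n$ so that its arc set is $\{v_iv_j : i<j\}$. The sequence $b(T_n)/n$ is known to converge as $n\to\infty$.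
   Formalization: The displayed chain is stated for n ≥ 3: at n = 1 the strict inequality fails (−2 against about 0.32) and at n = 2 the radicand is −3. Bars are taken to be pairwise disjoint, since superimposed bars would make the bound false. *)

theory Defs
  imports "HOL-Analysis.Analysis" "Graph_Theory.Pair_Digraph"
begin

section \<open>Bars and visibility\<close>

text \<open>The intended bars satisfy \<open>bar_left p < bar_right p\<close>; this is required in
  \<open>bar_visibility_rep\<close> below.\<close>

datatype bar = Bar (bar_left: real) (bar_right: real) (bar_height: real)

definition bar_segment :: "bar \<Rightarrow> (real \<times> real) set" where
  "bar_segment p = {bar_left p..bar_right p} \<times> {bar_height p}"

text \<open>\<open>bar_sees S p q\<close>: among the bars in \<open>S\<close>, the bar \<open>p\<close> sees the bar \<open>q\<close> above it through the
  channel \<open>{a..b} \<times> UNIV\<close>. As usual for bar visibility, the channel joins the two bars along its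
  whole width, i.e. it lies over \<open>p\<close> and under \<open>q\<close>. Every other bar blocks, including the other
  bars assigned to the same vertices.\<close>

definition bar_sees :: "bar set \<Rightarrow> bar \<Rightarrow> bar \<Rightarrow> bool" where
  "bar_sees S p q \<longleftrightarrow>
     bar_height p < bar_height q \<and>
     (\<exists>a b. a < b \<and>
        {a..b} \<subseteq> {bar_left p..bar_right p} \<and>
        {a..b} \<subseteq> {bar_left q..bar_right q} \<and>
        (\<forall>r \<in> S - {p, q}.
           bar_segment r \<inter> ({a..b} \<times> {bar_height p..bar_height q}) = {}))"

text \<open>Bars are pairwise disjoint segments; in particular no bar is shared by two vertices. Without
  this convention, bars of different vertices could be superimposed and none would block another.\<close>

definition bar_visibility_rep ::
  "nat \<Rightarrow> ('a, 'b) pre_digraph \<Rightarrow> ('a \<Rightarrow> bar set) \<Rightarrow> bool" where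
  "bar_visibility_rep t G f \<longleftrightarrow>
     (\<forall>x \<in> verts G. finite (f x) \<and> card (f x) \<le> t \<and> (\<forall>p \<in> f x. bar_left p < bar_right p)) \<and>
     (\<forall>x \<in> verts G. \<forall>y \<in> verts G. \<forall>p \<in> f x. \<forall>q \<in> f y.
        (x, p) \<noteq> (y, q) \<longrightarrow> bar_segment p \<inter> bar_segment q = {}) \<and>
     (\<forall>x \<in> verts G. \<forall>y \<in> verts G. x \<noteq> y \<longrightarrow>
        (x \<rightarrow>\<^bsub>G\<^esub> y \<longleftrightarrow> (\<exists>p \<in> f x. \<exists>q \<in> f y. bar_sees (\<Union>z \<in> verts G. f z) p q)))"

definition bar_visibility_number :: "('a, 'b) pre_digraph \<Rightarrow> nat" where
  "bar_visibility_number G = (LEAST t. \<exists>f. bar_visibility_rep t G f)"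

section \<open>Transitive tournaments\<close>

definition tournament :: "('a, 'b) pre_digraph \<Rightarrow> bool" where
  "tournament G \<longleftrightarrow> digraph G \<and>
     (\<forall>x \<in> verts G. \<forall>y \<in> verts G. x \<noteq> y \<longrightarrow> (x \<rightarrow>\<^bsub>G\<^esub> y) \<noteq> (y \<rightarrow>\<^bsub>G\<^esub> x))"

definition transitive_tournament :: "nat \<Rightarrow> nat pair_pre_digraph" where
  "transitive_tournament n = \<lparr>pverts = {1..n}, parcs = {(i, j). i \<in> {1..n} \<and> j \<in> {1..n} \<and> i < j}\<rparr>"

lemma tournament_transitive_tournament: "tournament (with_proj (transitive_tournament n))"
proof -
  have "finite (parcs (transitive_tournament n))"
    by (rule finite_subset[of _ "{1..n} \<times> {1..n}"]) (auto simp: transitive_tournament_def)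
  then interpret pair_digraph "transitive_tournament n"
    by unfold_locales (auto simp: transitive_tournament_def)
  have "digraph (with_proj (transitive_tournament n))" by unfold_locales
  then show ?thesis by (auto simp: tournament_def transitive_tournament_def)
qed

lemma trans_transitive_tournament: "trans (arcs_ends (with_proj (transitive_tournament n)))"
  by (auto simp: transitive_tournament_def trans_def)

end

theory Submission
  imports Defs
begin

text \<open>Sweep a vertical line from left to right over a representation. The bars it meets have weakly
  increasing vertex indices from bottom to top, and every arc is first realised either when one of
  its two bars starts, or when a bar lying between them ends. Hence a bar of an inner vertex creates
  at most one arc with its lower neighbour, one with its upper neighbour, and one when it ends,
  which would give about \<open>3tn\<close> arcs. The saving of order \<open>t\<^sup>2\<close> comes from the extreme vertices: bars of
  \<open>v\<^sub>j\<close> can create at most \<open>j - 1\<close> arcs with lower neighbours and at most \<open>n - j\<close> with upper ones.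
  Finally, an arc \<open>v\<^sub>1v\<^sub>j\<close> created by the start of a bar of \<open>v\<^sub>1\<close> is paid for by an event that exposed
  \<open>v\<^sub>j\<close> at the bottom without creating an arc, and symmetrically for \<open>v\<^sub>n\<close> at the top.
  Together this yields \<open>n(n - 1)/2 \<le> t(3n - t - 5)\<close> whenever \<open>t \<le> n - 1\<close>.\<close>

section \<open>Sweeping over labelled intervals\<close>

lemma finite_has_maximal_key:
  fixes f :: "'a \<Rightarrow> 'b::linorder"
  assumes "finite A" "A \<noteq> {}"
  obtains x where "x \<in> A" "\<And>y. y \<in> A \<Longrightarrow> f y \<le> f x"
proof -
  have "Max (f ` A) \<in> f ` A" using assms by (intro Max_in) auto
  then obtain x where x: "x \<in> A" "f x = Max (f ` A)" by auto
  show thesis using that[of x] x assms(1) by simp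
qed

text \<open>What the sweep uses about bars: endpoints are distinct, so that each event is a single
  start or end, and labels grow weakly with height among overlapping intervals. Labels are integers
  because the reflection exchanging the two extreme vertices negates them.\<close>

locale sweep =
  fixes P :: "'b set" and l r h :: "'b \<Rightarrow> real" and lab :: "'b \<Rightarrow> int"
  assumes fin: "finite P"
    and l_less_r: "p \<in> P \<Longrightarrow> l p < r p"
    and l_inj: "\<lbrakk>p \<in> P; q \<in> P; l p = l q\<rbrakk> \<Longrightarrow> p = q"
    and r_inj: "\<lbrakk>p \<in> P; q \<in> P; r p = r q\<rbrakk> \<Longrightarrow> p = q"
    and l_neq_r: "\<lbrakk>p \<in> P; q \<in> P\<rbrakk> \<Longrightarrow> l p \<noteq> r q"
    and h_inj: "\<lbrakk>p \<in> P; q \<in> P; l p < r q; l q < r p; h p = h q\<rbrakk> \<Longrightarrow> p = q"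
    and lab_mono: "\<lbrakk>p \<in> P; q \<in> P; l p < r q; l q < r p; h p < h q\<rbrakk> \<Longrightarrow> lab p \<le> lab q"
begin

text \<open>Half-open intervals make \<open>act s\<close> the state just after the event at
  \<open>s\<close>: an interval starting there is already present, one ending there is already
  gone.\<close>

definition act :: "real \<Rightarrow> 'b set" where
  "act s = {p \<in> P. l p \<le> s \<and> s < r p}"

definition adj :: "'b set \<Rightarrow> 'b \<Rightarrow> 'b \<Rightarrow> bool" where
  "adj X p q \<longleftrightarrow> p \<in> X \<and> q \<in> X \<and> h p < h q \<and> (\<forall>z\<in>X. \<not> (h p < h z \<and> h z < h q))"

definition seen :: "int \<Rightarrow> int \<Rightarrow> real \<Rightarrow> bool" where
  "seen i j s \<longleftrightarrow> (\<exists>p q. adj (act s) p q \<and> lab p = i \<and> lab q = j)"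

definition created :: "int \<Rightarrow> int \<Rightarrow> real \<Rightarrow> bool" where
  "created i j s \<longleftrightarrow> seen i j s \<and> (\<forall>s'<s. \<not> seen i j s')"

text \<open>This set and the next two sort pairs by the event at which they first become adjacent:
  the start of the upper interval, the start of the lower one, or the end of some interval.\<close>

definition new_top :: "(int \<times> int) set" where
  "new_top = {(i, j). i < j \<and> (\<exists>q\<in>P. lab q = j \<and> created i j (l q))}"

definition new_bot :: "(int \<times> int) set" where
  "new_bot = {(i, j). i < j \<and> (\<exists>p\<in>P. lab p = i \<and> created i j (l p))}"

definition new_del :: "(int \<times> int) set" where
  "new_del = {(i, j). i < j \<and> (\<exists>d\<in>P. created i j (r d))}"

section \<open>Active sets around an endpoint and the creation of pairs\<close>

lemma act_subset: "act s \<subseteq> P" and finite_act: "finite (act s)"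
  using fin by (auto simp: act_def)

lemma act_h_inj: "\<lbrakk>p \<in> act s; q \<in> act s; h p = h q\<rbrakk> \<Longrightarrow> p = q"
  unfolding act_def using h_inj by fastforce

lemma act_lab_mono: "\<lbrakk>p \<in> act s; q \<in> act s; h p < h q\<rbrakk> \<Longrightarrow> lab p \<le> lab q"
  unfolding act_def using lab_mono by fastforce

lemma created_unique: "\<lbrakk>created i j s; created i j s'\<rbrakk> \<Longrightarrow> s = s'"
  unfolding created_def by (metis linorder_neqE)

text \<open>There are finitely many endpoints, so some \<open>s'\<close> to the left of
  \<open>s\<close> lies beyond all endpoints smaller than \<open>s\<close>.\<close>

lemma ex_act_before: "\<exists>s'<s. act s' = {p \<in> P. l p < s \<and> s \<le> r p}"
proof -
  have "\<forall>\<^sub>F s' in at_left s. \<forall>x\<in>l ` P \<union> r ` P. x < s \<longrightarrow> x < s'"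
  proof (intro eventually_ball_finite ballI)
    show "finite (l ` P \<union> r ` P)" using fin by simp
    fix x
    show "\<forall>\<^sub>F s' in at_left s. x < s \<longrightarrow> x < s'"
      by (cases "x < s") (auto simp: eventually_at_left intro: exI[of _ x])
  qed
  moreover have "\<forall>\<^sub>F s' in at_left s. s' < s"
    by (simp add: eventually_at_filter)
  ultimately have "\<forall>\<^sub>F s' in at_left s. s' < s \<and> (\<forall>x\<in>l ` P \<union> r ` P. x < s \<longrightarrow> x < s')"
    by eventually_elim simp
  then obtain s' where s': "s' < s" "\<And>x. x \<in> l ` P \<union> r ` P \<Longrightarrow> x < s \<Longrightarrow> x < s'"
    by (metis (no_types, lifting) eventually_happens trivial_limit_at_left_real)
  have "act s' = {p \<in> P. l p < s \<and> s \<le> r p}"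
  proof -
    have "l p \<le> s' \<and> s' < r p \<longleftrightarrow> l p < s \<and> s \<le> r p" if "p \<in> P" for p
      using that s'(1) s'(2)[of "l p"] s'(2)[of "r p"] by force
    then show ?thesis by (auto simp: act_def)
  qed
  with s'(1) show ?thesis by blast
qed

lemma ex_act_before_left: 
  assumes "z \<in> P"
  shows "\<exists>s'<l z. act s' = act (l z) - {z}"
proof -
  have "l p < l z \<and> l z \<le> r p \<longleftrightarrow> l p \<le> l z \<and> l z < r p \<and> p \<noteq> z" if "p \<in> P" for p
    using assms that l_inj[of p z] l_neq_r[of z p] l_less_r[of z] by (cases "l p = l z") auto
  then have "{p \<in> P. l p < l z \<and> l z \<le> r p} = act (l z) - {z}" by (auto simp: act_def)
  then show ?thesis using ex_act_before[of "l z"] by simp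
qed

lemma ex_act_before_right: 
  assumes "d \<in> P"
  shows "\<exists>s'<r d. act s' = insert d (act (r d))"
proof -
  have "l p < r d \<and> r d \<le> r p \<longleftrightarrow> p = d \<or> l p \<le> r d \<and> r d < r p" if "p \<in> P" for p
    using assms that r_inj[of p d] l_neq_r[of p d] l_less_r[of d] by (cases "r p = r d") auto
  then have "{p \<in> P. l p < r d \<and> r d \<le> r p} = insert d (act (r d))"
    using assms by (auto simp: act_def)
  then show ?thesis using ex_act_before[of "r d"] by simp
qed

text \<open>The active set is constant between events, so the last endpoint not exceeding
  \<open>s\<close> has the same state; it exists because an active interval has already
  started.\<close>

lemma ex_event_act:
  assumes "act s \<noteq> {}"
  shows "\<exists>x\<in>l ` P \<union> r ` P. x \<le> s \<and> act x = act s"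
proof -
  let ?E = "{x \<in> l ` P \<union> r ` P. x \<le> s}"
  have fE: "finite ?E" and neE: "?E \<noteq> {}" using fin assms by (auto simp: act_def)
  let ?x = "Max ?E"
  have x: "?x \<in> ?E" using Max_in[OF fE neE] .
  have mx: "y \<le> ?x" if "y \<in> l ` P \<union> r ` P" "y \<le> s" for y using Max_ge[OF fE, of y] that by simp
  have "l p \<le> ?x \<and> ?x < r p \<longleftrightarrow> l p \<le> s \<and> s < r p" if "p \<in> P" for p
    using mx[of "l p"] mx[of "r p"] x that by force
  then have "act ?x = act s" by (auto simp: act_def)
  then show ?thesis using x by blast
qed

lemma seen_event:
  assumes "seen i j s" shows "\<exists>x\<in>l ` P \<union> r ` P. x \<le> s \<and> seen i j x"
proof -
  have "act s \<noteq> {}" using assms by (auto simp: seen_def adj_def)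
  from ex_event_act[OF this] obtain x where "x \<in> l ` P \<union> r ` P" "x \<le> s" "act x = act s" by blast
  then show ?thesis using assms unfolding seen_def by (metis (no_types))
qed

lemma created_event: "created i j s \<Longrightarrow> s \<in> l ` P \<union> r ` P"
  using seen_event[of i j s] unfolding created_def by (metis order_le_less)

lemma ex_created:
  assumes "seen i j s" shows "\<exists>s'. created i j s'"
proof -
  let ?T = "{x \<in> l ` P \<union> r ` P. seen i j x}"
  have f: "finite ?T" using fin by simp
  have ne: "?T \<noteq> {}" using seen_event[OF assms] by blast
  have "\<not> seen i j s'" if "s' < Min ?T" for s'
  proof
    assume "seen i j s'"
    then obtain x where "x \<in> ?T" "x \<le> s'" using seen_event by blast
    then show False using Min_le[OF f \<open>x \<in> ?T\<close>] that by linarith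
  qed
  moreover have "seen i j (Min ?T)" using Min_in[OF f ne] by blast
  ultimately have "created i j (Min ?T)" unfolding created_def by blast
  then show ?thesis ..
qed

text \<open>Removing an interval other than \<open>p\<close> and \<open>q\<close> leaves these two
  adjacent, so the pair would have been seen just before \<open>z\<close> starts.\<close>

lemma created_left:
  assumes "z \<in> P" "created i j (l z)" "adj (act (l z)) p q" "lab p = i" "lab q = j"
  shows "z = p \<or> z = q"
proof (rule ccontr)
  assume n: "\<not> (z = p \<or> z = q)"
  obtain s' where "s' < l z" "act s' = act (l z) - {z}" using ex_act_before_left[OF assms(1)] by blast
  moreover from this have "adj (act s') p q" using assms(3) n by (auto simp: adj_def)
  ultimately show False using assms(2,4,5) by (auto simp: created_def seen_def)
qed

text \<open>Unless \<open>d\<close> separated \<open>p\<close> from \<open>q\<close>, they were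
  adjacent before it ended. Just before its end \<open>d\<close> is adjacent to both, so with label
  \<open>i\<close> or \<open>j\<close> it would already have shown the pair.\<close>

lemma created_right:
  assumes "d \<in> P" "created i j (r d)" "i < j" "adj (act (r d)) p q" "lab p = i" "lab q = j"
  shows "h p < h d" "h d < h q" "i < lab d" "lab d < j"
proof -
  obtain s' where s': "s' < r d" "act s' = insert d (act (r d))"
    using ex_act_before_right[OF assms(1)] by blast
  have ns: "\<not> seen i j s'" using assms(2) s'(1) by (simp add: created_def)
  then have "\<not> adj (act s') p q" using assms(5,6) by (auto simp: seen_def)
  then show b: "h p < h d" "h d < h q" using assms(4) s'(2) by (auto simp: adj_def)
  have m: "p \<in> act s'" "q \<in> act s'" "d \<in> act s'" using s' assms(4) by (auto simp: adj_def)
  have "adj (act s') p d" "adj (act s') d q"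
    using assms(4) s'(2) b by (auto simp: adj_def)
  then have "lab d \<noteq> i" "lab d \<noteq> j" using ns assms(5,6) by (auto simp: seen_def)
  moreover have "i \<le> lab d" "lab d \<le> j" using act_lab_mono m b assms(5,6) by blast+
  ultimately show "i < lab d" "lab d < j" by simp_all
qed

section \<open>Classification of pairs by the event that creates them\<close>

lemma new_top_adj:
  assumes "q \<in> P" "lab q = j" "created i j (l q)" "i < j"
  obtains p where "adj (act (l q)) p q" "lab p = i"
proof -
  obtain p q' where "adj (act (l q)) p q'" "lab p = i" "lab q' = j"
    using assms(3) by (auto simp: created_def seen_def)
  then show thesis using created_left[of q i j p q'] assms that by auto
qed

lemma new_bot_adj:
  assumes "p \<in> P" "lab p = i" "created i j (l p)" "i < j"
  obtains q where "adj (act (l p)) p q" "lab q = j"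
proof -
  obtain p' q where "adj (act (l p)) p' q" "lab p' = i" "lab q = j"
    using assms(3) by (auto simp: created_def seen_def)
  then show thesis using created_left[of p i j p' q] assms that by auto
qed

lemma adj_below_unique:
  assumes "adj (act s) p q" "adj (act s) p' q" shows "p = p'"
  using assms act_h_inj[of p s p'] unfolding adj_def by (metis linorder_neqE)

lemma adj_across_unique:
  assumes "adj (act s) p q" "adj (act s) p' q'" "h p < x" "x < h q" "h p' < x" "x < h q'"
  shows "p = p'" "q = q'"
proof -
  have "h p = h p'" "h q = h q'"
    using assms unfolding adj_def by (smt (verit))+
  then show "p = p'" "q = q'" using assms act_h_inj unfolding adj_def by blast+
qed

text \<open>The creation point is unique and starts are distinct, so a common pair would come from
  one interval carrying both labels.\<close>

lemma new_top_bot_disjoint: "new_top \<inter> new_bot = {}"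
proof -
  have False if "q \<in> P" "p \<in> P" "lab p < lab q" "created (lab p) (lab q) (l q)"
    "created (lab p) (lab q) (l p)" for p q
    using created_unique[OF that(4,5)] l_inj[OF that(1,2)] that(3) by auto
  then show ?thesis by (auto simp: new_top_def new_bot_def)
qed

lemma new_cases:
  assumes "i < j" "seen i j s"
  shows "(i, j) \<in> new_top \<union> new_bot \<union> new_del"
proof -
  obtain s where s: "created i j s" using ex_created[OF assms(2)] ..
  obtain p q where pq: "adj (act s) p q" "lab p = i" "lab q = j"
    using s by (auto simp: created_def seen_def)
  consider z where "z \<in> P" "s = l z" | d where "d \<in> P" "s = r d" using created_event[OF s] by blast
  then show ?thesis
  proof cases
    case 1
    then show ?thesis using created_left[of z i j p q] s pq assms(1)
      by (auto simp: new_top_def new_bot_def)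
  next
    case 2
    then show ?thesis using s assms(1) by (auto simp: new_del_def)
  qed
qed

section \<open>Charging pairs to starts and ends of intervals\<close>

lemma card_new_top_le:
  "card {i. (i, j) \<in> new_top} \<le> card {q \<in> P. lab q = j \<and> (\<exists>z\<in>act (l q). h z < h q)}"
\<comment> \<open>A start of \<open>q\<close> accounts for only one \<open>i\<close>, since at most
  one interval lies directly below \<open>q\<close>.\<close>
proof (rule card_le_if_inj_on_rel[where r = "\<lambda>i q. i < j \<and> q \<in> P \<and> lab q = j \<and> created i j (l q)"])
  show "finite {q \<in> P. lab q = j \<and> (\<exists>z\<in>act (l q). h z < h q)}" using fin by simp
next
  fix i assume "i \<in> {i. (i, j) \<in> new_top}"
  then obtain q where q: "i < j" "q \<in> P" "lab q = j" "created i j (l q)" by (auto simp: new_top_def)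
  obtain p where "adj (act (l q)) p q" using new_top_adj[of q j i] q by blast
  then have "\<exists>z\<in>act (l q). h z < h q" by (auto simp: adj_def)
  with q show "\<exists>q. q \<in> {q \<in> P. lab q = j \<and> (\<exists>z\<in>act (l q). h z < h q)} \<and> i < j \<and> q \<in> P \<and> lab q = j \<and> created i j (l q)"
    by blast
next
  fix i i' q
  assume a: "i < j \<and> q \<in> P \<and> lab q = j \<and> created i j (l q)" "i' < j \<and> q \<in> P \<and> lab q = j \<and> created i' j (l q)"
  obtain p where "adj (act (l q)) p q" "lab p = i" using a new_top_adj[of q j i] by blast
  moreover obtain p' where "adj (act (l q)) p' q" "lab p' = i'" using a new_top_adj[of q j i'] by blast
  ultimately show "i = i'" using adj_below_unique by blast
qed

text \<open>Just before \<open>p\<close> starts, its upper neighbour-to-be \<open>q\<close> is the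
  lowest active interval. Either \<open>q\<close> started with nothing below it, or it was exposed
  by the last interval below it to end.\<close>

lemma new_bot_charge:
  assumes e: "\<forall>p\<in>P. e \<le> lab p" and new: "(e, j) \<in> new_bot"
  shows "(\<exists>q\<in>P. lab q = j \<and> (\<forall>z\<in>act (l q). \<not> h z < h q)) \<or>
    (\<exists>d\<in>P. e < lab d \<and> lab d \<le> j \<and>
       (\<exists>q\<in>act (r d). lab q = j \<and> h d < h q \<and> (\<forall>z\<in>act (r d). h q \<le> h z)))"
proof -
  obtain p where p: "e < j" "p \<in> P" "lab p = e" "created e j (l p)" using new by (auto simp: new_bot_def)
  obtain q where q: "adj (act (l p)) p q" "lab q = j" using new_bot_adj p by blast
  let ?s = "l p"
  have qP: "q \<in> P" and "q \<noteq> p" using q act_subset by (auto simp: adj_def)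
  have "l q \<noteq> l p" using l_inj qP p(2) \<open>q \<noteq> p\<close> by blast
  then have lq: "l q < ?s" and rq: "?s < r q" using q(1) by (auto simp: adj_def act_def)
  obtain s' where s': "s' < ?s" "act s' = act ?s - {p}" using ex_act_before_left[OF p(2)] by blast
  \<comment> \<open>The highest interval \<open>w\<close> below \<open>q\<close> would also lie
    below \<open>p\<close>, hence carry the minimal label \<open>e\<close> and show the pair before
    \<open>p\<close> starts.\<close>
  have bottom: "\<not> h z < h q" if z: "z \<in> act s'" for z
  proof
    assume "h z < h q"
    then have ne: "{z \<in> act s'. h z < h q} \<noteq> {}" using z by blast
    obtain w where w: "w \<in> act s'" "h w < h q"
      and mx: "\<And>z. z \<in> act s' \<Longrightarrow> h z < h q \<Longrightarrow> h z \<le> h w"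
      by (rule finite_has_maximal_key[OF _ ne, of h]) (use finite_act in auto)
    have "adj (act s') w q" using w mx q(1) s'(2) \<open>q \<noteq> p\<close> by (force simp: adj_def)
    moreover have "lab w = e"
    proof -
      have "w \<in> act ?s" "w \<noteq> p" "p \<in> act ?s" using w s'(2) q(1) by (auto simp: adj_def)
      then have "h w < h p" using q(1) w(2) act_h_inj[of w ?s p] unfolding adj_def by (metis linorder_neqE)
      then have "lab w \<le> e" using act_lab_mono \<open>w \<in> act ?s\<close> \<open>p \<in> act ?s\<close> p(3) by blast
      then show ?thesis using e \<open>w \<in> act ?s\<close> act_subset by (meson order_antisym subsetD)
    qed
    ultimately have "seen e j s'" using q(2) by (auto simp: seen_def)
    then show False using p(4) s'(1) by (auto simp: created_def)
  qed
  have gone: "r w < ?s" if "w \<in> P" "h w < h q" "l w < ?s" for w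
  proof (rule ccontr)
    assume "\<not> r w < ?s"
    then have "?s < r w" using l_neq_r[OF p(2) that(1)] by simp
    then have "w \<in> act s'" using that s'(2) by (auto simp: act_def)
    then show False using bottom that(2) by blast
  qed
  show ?thesis
  proof (cases "\<forall>z\<in>act (l q). \<not> h z < h q")
    case True
    then show ?thesis using qP q(2) by blast
  next
    case False
    then obtain z where z: "z \<in> act (l q)" "h z < h q" by blast
    \<comment> \<open>The intervals below \<open>q\<close> that end during the life of
      \<open>q\<close> and before \<open>p\<close> starts; the last of them to end is the required
      \<open>d\<close>.\<close>
    let ?Z = "{z \<in> P. h z < h q \<and> l q < r z \<and> r z < ?s}"
    have "r z < ?s" using gone[of z] z lq by (auto simp: act_def)
    then have "z \<in> ?Z" using z by (auto simp: act_def)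
    then have Z: "?Z \<noteq> {}" "finite ?Z" using fin by auto
    obtain d where d: "d \<in> ?Z" and mx: "\<And>w. w \<in> ?Z \<Longrightarrow> r w \<le> r d"
      by (rule finite_has_maximal_key[OF Z(2,1), of r]) (rule that; assumption?; simp)
    have dP: "d \<in> P" and qd: "q \<in> act (r d)" using d qP rq by (auto simp: act_def)
    have low: "h q \<le> h w" if w: "w \<in> act (r d)" for w
    proof (rule ccontr)
      assume "\<not> h q \<le> h w"
      then have "h w < h q" by simp
      moreover have "w \<in> P" "l w \<le> r d" "r d < r w" using w by (auto simp: act_def)
      moreover have "r w < ?s" using gone[of w] calculation d by auto
      ultimately have "w \<in> ?Z" using d by auto
      then show False using mx[of w] \<open>r d < r w\<close> by simp
    qed
    \<comment> \<open>Just before it ends, \<open>d\<close> is adjacent to \<open>q\<close>, so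
      label \<open>e\<close> for \<open>d\<close> would show the pair before its creation.\<close>
    obtain s2 where s2: "s2 < r d" "act s2 = insert d (act (r d))" using ex_act_before_right[OF dP] by blast
    have m: "d \<in> act s2" "q \<in> act s2" "h d < h q" using s2 qd d by auto
    then have adj: "adj (act s2) d q" using low s2(2) by (force simp: adj_def)
    have "\<not> seen e j s2" using p(4) s2(1) d by (auto simp: created_def)
    then have "lab d \<noteq> e" using adj q(2) by (auto simp: seen_def)
    then have "e < lab d" using e dP by (simp add: order_less_le)
    moreover have "lab d \<le> j" using act_lab_mono[OF m] q(2) by simp
    ultimately show ?thesis using dP qd q(2) m(3) low
      by (intro disjI2 bexI[of _ d] conjI bexI[of _ q] ballI) simp_all
  qed
qed


text \<open>With \<open>e\<close> and \<open>e'\<close> as extreme labels, these are the inner ends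
  that leave an inner interval at the bottom. The ended interval had nothing below it, so such an
  end creates no pair. Asking for an inner label of \<open>q\<close> keeps the last inner end out of
  the set.\<close>

definition exposing :: "int \<Rightarrow> int \<Rightarrow> 'b set" where
  "exposing e e' = {d \<in> P. lab d \<in> {e<..<e'} \<and>
     (\<exists>q\<in>act (r d). lab q \<in> {e<..<e'} \<and> h d < h q \<and> (\<forall>z\<in>act (r d). h q \<le> h z))}"

lemma seen_labels:
  assumes "seen i j s" shows "\<exists>p\<in>P. lab p = i" "\<exists>q\<in>P. lab q = j"
  using assms act_subset unfolding seen_def adj_def by blast+

lemma new_top_subset:
  assumes "\<forall>p\<in>P. e \<le> lab p"
  shows "{i. (i, j) \<in> new_top} \<subseteq> {e..<j}"
proof
  fix i assume "i \<in> {i. (i, j) \<in> new_top}"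
  then obtain s where "i < j" "seen i j s" by (auto simp: new_top_def created_def)
  then show "i \<in> {e..<j}" using seen_labels(1)[of i j s] assms by auto
qed

text \<open>A pair \<open>(e, j)\<close> in \<open>new_bot\<close> is paid for by
  \<open>new_bot_charge\<close>: either by a start of label \<open>j\<close> that has nothing below
  it and so creates no \<open>new_top\<close> pair, or by an exposing end.\<close>

lemma card_new_top_new_bot_le:
  assumes lab: "\<forall>p\<in>P. e \<le> lab p" and t: "\<forall>j. card {p \<in> P. lab p = j} \<le> t"
  shows "(\<Sum>j\<in>{e<..<e'}. card {i. (i, j) \<in> new_top}) + card {j \<in> {e<..<e'}. (e, j) \<in> new_bot}
    \<le> (\<Sum>j\<in>{e<..<e'}. min (nat (j - e)) t) + card (exposing e e')"
proof -
  let ?M = "{e<..<e'}"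
  define S where "S = {j \<in> ?M. (e, j) \<in> new_bot}"
  define S1 where "S1 = {j \<in> S. \<exists>q\<in>P. lab q = j \<and> (\<forall>z\<in>act (l q). \<not> h z < h q)}"
  have sub: "S \<subseteq> ?M" "S1 \<subseteq> S" by (auto simp: S_def S1_def)
  then have fS: "finite S" "finite S1" by (meson finite_greaterThanLessThan_int finite_subset)+
  have "card (S - S1) \<le> card (exposing e e')"
  \<comment> \<open>The end of \<open>d\<close> determines the lowest remaining interval and thereby
    \<open>j\<close>.\<close>
  proof (rule card_le_if_inj_on_rel[where r = "\<lambda>j d. \<exists>q\<in>act (r d). lab q = j \<and> (\<forall>z\<in>act (r d). h q \<le> h z)"])
    show "finite (exposing e e')" using fin by (simp add: exposing_def)
  next
    fix j assume j: "j \<in> S - S1"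
    then have new: "(e, j) \<in> new_bot" "j \<in> ?M" by (auto simp: S_def)
    obtain d q where d: "d \<in> P" "e < lab d" "lab d \<le> j" "q \<in> act (r d)" "lab q = j" "h d < h q"
      "\<forall>z\<in>act (r d). h q \<le> h z"
      using new_bot_charge[OF lab new(1)] j by (auto simp: S1_def)
    then have "d \<in> exposing e e'" using new(2) by (auto simp: exposing_def intro!: bexI[of _ q])
    then show "\<exists>d. d \<in> exposing e e' \<and> (\<exists>q\<in>act (r d). lab q = j \<and> (\<forall>z\<in>act (r d). h q \<le> h z))"
      using d by blast
  next
    fix j j' d
    assume "\<exists>q\<in>act (r d). lab q = j \<and> (\<forall>z\<in>act (r d). h q \<le> h z)"
      and "\<exists>q\<in>act (r d). lab q = j' \<and> (\<forall>z\<in>act (r d). h q \<le> h z)"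
    then show "j = j'" by (metis act_h_inj order_antisym)
  qed
  then have S: "card S \<le> card S1 + card (exposing e e')"
    using card_Diff_subset[OF fS(2) sub(2)] card_mono[OF fS(1) sub(2)] by linarith
  \<comment> \<open>For \<open>j\<close> in \<open>S1\<close> both arguments of the minimum have a
    spare unit: \<open>(e, j)\<close> itself is not in \<open>new_top\<close>, and one interval of
    label \<open>j\<close> starts with nothing below it.\<close>
  have "card {i. (i, j) \<in> new_top} + of_bool (j \<in> S1) \<le> min (nat (j - e)) t" if j: "j \<in> ?M" for j
  proof -
    have fj: "finite {p \<in> P. lab p = j}" using fin by simp
    have tj: "card {p \<in> P. lab p = j} \<le> t" using t by blast
    let ?Q = "{q \<in> P. lab q = j \<and> (\<exists>z\<in>act (l q). h z < h q)}"
    have Q: "card {i. (i, j) \<in> new_top} \<le> card ?Q" by (rule card_new_top_le)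
    show ?thesis
    proof (cases "j \<in> S1")
      case True
      then have "(e, j) \<notin> new_top" using new_top_bot_disjoint by (auto simp: S1_def S_def)
      then have "{i. (i, j) \<in> new_top} \<subseteq> {e..<j} - {e}" using new_top_subset[OF lab, of j] by blast
      also have "\<dots> = {e<..<j}" by auto
      finally have "card {i. (i, j) \<in> new_top} \<le> card {e<..<j}" by (intro card_mono) simp
      then have "card {i. (i, j) \<in> new_top} \<le> nat (j - e) - 1" using j by (simp add: nat_diff_distrib)
      moreover have "?Q \<subset> {p \<in> P. lab p = j}" using True by (auto simp: S1_def)
      then have "card ?Q < card {p \<in> P. lab p = j}" by (rule psubset_card_mono[OF fj])
      ultimately show ?thesis using Q tj True j by auto
    next
      case False
      have "card {i. (i, j) \<in> new_top} \<le> nat (j - e)"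
        using card_mono[OF _ new_top_subset[OF lab, of j]] by simp
      moreover have "card ?Q \<le> card {p \<in> P. lab p = j}" by (rule card_mono[OF fj]) auto
      ultimately show ?thesis using Q tj False by auto
    qed
  qed
  then have "(\<Sum>j\<in>?M. card {i. (i, j) \<in> new_top} + of_bool (j \<in> S1)) \<le> (\<Sum>j\<in>?M. min (nat (j - e)) t)"
    by (rule sum_mono)
  moreover have "(\<Sum>j\<in>?M. of_bool (j \<in> S1)) = card S1"
    using sub by (simp add: Int_absorb1 subset_trans[OF sub(2,1)] Collect_conj_eq)
  ultimately show ?thesis using S by (simp add: sum.distrib S_def)
qed

text \<open>Turning the picture upside down swaps the roles of the two extreme labels, so every
  estimate at the bottom also yields one at the top.\<close>

lemma mirror: "sweep P l r (\<lambda>p. - h p) (\<lambda>p. - lab p)"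
  by unfold_locales (use fin l_less_r l_inj r_inj l_neq_r h_inj lab_mono in auto)

text \<open>The summand 1 is the inner interval that ends last: it can only have intervals with the extreme
  labels as neighbours, so it creates at most the excluded pair \<open>(e, e')\<close>.\<close>

lemma card_new_del_le:
  assumes mid: "\<exists>p\<in>P. lab p \<in> {e<..<e'}"
  shows "card {(i, j) \<in> new_del. (i, j) \<noteq> (e, e') \<and> e \<le> i \<and> j \<le> e'} + card (exposing e e')
    + card (sweep.exposing P l r (\<lambda>p. - h p) (\<lambda>p. - lab p) (- e') (- e)) + 1
    \<le> card {p \<in> P. lab p \<in> {e<..<e'}}"
proof -
  interpret mir: sweep P l r "\<lambda>p. - h p" "\<lambda>p. - lab p" by (rule mirror)
  let ?M = "{e<..<e'}" and ?Pm = "{p \<in> P. lab p \<in> {e<..<e'}}"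
  let ?D = "{(i, j) \<in> new_del. (i, j) \<noteq> (e, e') \<and> e \<le> i \<and> j \<le> e'}"
  define X where "X = exposing e e'"
  define X' where "X' = mir.exposing (- e') (- e)"
  have X': "X' = {d \<in> ?Pm. \<exists>q\<in>act (r d). lab q \<in> ?M \<and> h q < h d \<and> (\<forall>z\<in>act (r d). h z \<le> h q)}"
    by (auto simp: X'_def mir.exposing_def)
  have X: "X = {d \<in> ?Pm. \<exists>q\<in>act (r d). lab q \<in> ?M \<and> h d < h q \<and> (\<forall>z\<in>act (r d). h q \<le> h z)}"
    by (auto simp: X_def exposing_def)
  have fPm: "finite ?Pm" and nePm: "?Pm \<noteq> {}" using fin mid by auto
  obtain m where m: "m \<in> ?Pm" and mx: "\<And>p. p \<in> ?Pm \<Longrightarrow> r p \<le> r m"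
    using finite_has_maximal_key[OF fPm nePm, of r] by auto
  have last: "lab q \<notin> ?M" if "q \<in> act (r m)" for q
    using that mx[of q] by (auto simp: act_def)
  have m_notin: "m \<notin> X" "m \<notin> X'" using last unfolding X X' by blast+
  \<comment> \<open>An interval in both sets would end below all remaining intervals and above all
    of them, although at least one remains.\<close>
  have disj: "X \<inter> X' = {}" unfolding X X' by (fastforce dest: order_less_le_trans order_less_trans)
  \<comment> \<open>Each pair in \<open>?D\<close> is created by an end in \<open>?R\<close>, and an
    end creates at most one pair, that of the two intervals around the gap.\<close>
  let ?R = "?Pm - (X \<union> X' \<union> {m})"
  have "card ?D \<le> card ?R"
  proof (rule card_le_if_inj_on_rel[where r = "\<lambda>(i, j) d. d \<in> P \<and> i < j \<and> created i j (r d)"])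
    show "finite ?R" using fPm by simp
  next
    fix x assume "x \<in> ?D"
    then obtain i j d where x: "x = (i, j)" "(i, j) \<noteq> (e, e')" "e \<le> i" "j \<le> e'" "i < j" "d \<in> P"
      "created i j (r d)"
      by (auto simp: new_del_def)
    obtain p q where pq: "adj (act (r d)) p q" "lab p = i" "lab q = j"
      using x(7) by (auto simp: created_def seen_def)
    note d = created_right[OF x(6,7,5) pq]
    have act: "p \<in> act (r d)" "q \<in> act (r d)" using pq by (auto simp: adj_def)
    \<comment> \<open>The interval \<open>p\<close> remains active below \<open>d\<close>, so
      \<open>d\<close> does not end at the bottom; \<open>q\<close> excludes the top in the same
      way.\<close>
    have "d \<notin> X" using act(1) d(1) unfolding X by fastforce
    moreover have "d \<notin> X'" using act(2) d(2) unfolding X' by fastforce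
    \<comment> \<open>No inner interval is active at the end of \<open>m\<close>, so the pair would
      be \<open>(e, e')\<close>.\<close>
    moreover have "d \<noteq> m" using last act pq(2,3) x(2-5) by fastforce
    ultimately have "d \<in> ?R" using x(3,4,6) d(3,4) by simp
    then show "\<exists>d. d \<in> ?R \<and> (case x of (i, j) \<Rightarrow> \<lambda>d. d \<in> P \<and> i < j \<and> created i j (r d)) d"
      using x by auto
  next
    fix x y d
    assume a: "(case x of (i, j) \<Rightarrow> \<lambda>d. d \<in> P \<and> i < j \<and> created i j (r d)) d"
      "(case y of (i, j) \<Rightarrow> \<lambda>d. d \<in> P \<and> i < j \<and> created i j (r d)) d"
    obtain i j i' j' where [simp]: "x = (i, j)" "y = (i', j')" by (cases x, cases y)
    have dP: "d \<in> P" and c: "i < j" "created i j (r d)" "i' < j'" "created i' j' (r d)" using a by auto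
    obtain p q where pq: "adj (act (r d)) p q" "lab p = i" "lab q = j"
      using c by (auto simp: created_def seen_def)
    obtain p' q' where pq': "adj (act (r d)) p' q'" "lab p' = i'" "lab q' = j'"
      using c by (auto simp: created_def seen_def)
    have "p = p' \<and> q = q'"
      using adj_across_unique[OF pq(1) pq'(1), of "h d"] created_right[OF dP c(2,1) pq]
        created_right[OF dP c(4,3) pq'] by blast
    then show "x = y" using pq pq' by simp
  qed
  moreover have XPm: "X \<union> X' \<union> {m} \<subseteq> ?Pm" using m unfolding X X' by blast
  then have fX: "finite X" "finite X'" using finite_subset[OF _ fPm] by auto
  have "card (X \<union> X' \<union> {m}) = card X + card X' + 1"
    using fX m_notin disj by (simp add: card_Un_disjoint)
  moreover have "card ?R = card ?Pm - card (X \<union> X' \<union> {m})"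
    using fX XPm by (intro card_Diff_subset) auto
  moreover have "card (X \<union> X' \<union> {m}) \<le> card ?Pm" by (rule card_mono[OF fPm XPm])
  ultimately show ?thesis unfolding X_def X'_def by linarith
qed

text \<open>Exposing ends are added in the two estimates for starts and subtracted in the one for
  ends, so they cancel, and the pair \<open>(e, e')\<close> takes the unit saved at the last inner
  end. What remains are the bounds for starts and at most \<open>t\<close> ends per inner
  label.\<close>

lemma count_pairs:
  assumes lab: "\<forall>p\<in>P. lab p \<in> {e..e'}" and t: "\<forall>j. card {p \<in> P. lab p = j} \<le> t"
    and mid: "\<exists>p\<in>P. lab p \<in> {e<..<e'}"
    and all: "\<And>i j. \<lbrakk>e \<le> i; i < j; j \<le> e'\<rbrakk> \<Longrightarrow> \<exists>s. seen i j s"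
  shows "card {(i, j). e \<le> i \<and> i < j \<and> j \<le> e'} \<le> (\<Sum>j\<in>{e<..<e'}. min (nat (j - e)) t)
    + (\<Sum>j\<in>{e<..<e'}. min (nat (e' - j)) t) + t * nat (e' - e - 1)"
proof -
  interpret mir: sweep P l r "\<lambda>p. - h p" "\<lambda>p. - lab p" by (rule mirror)
  \<comment> \<open>Reflection reverses adjacency and so exchanges \<open>new_top\<close> and
    \<open>new_bot\<close>, with each pair negated and swapped.\<close>
  have madj: "mir.adj X p q \<longleftrightarrow> adj X q p" for X p q by (auto simp: mir.adj_def adj_def)
  have mseen: "mir.seen i j s \<longleftrightarrow> seen (- j) (- i) s" for i j s
    unfolding mir.seen_def seen_def madj by (metis minus_minus)
  have mcreated: "mir.created i j s \<longleftrightarrow> created (- j) (- i) s" for i j s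
    by (simp add: mir.created_def created_def mseen)
  have neg_lab: "- lab p = j \<longleftrightarrow> lab p = - j" for p j by auto
  have mtop: "(i, j) \<in> mir.new_top \<longleftrightarrow> (- j, - i) \<in> new_bot" for i j
    by (simp add: mir.new_top_def new_bot_def mcreated neg_lab)
  have mbot: "(i, j) \<in> mir.new_bot \<longleftrightarrow> (- j, - i) \<in> new_top" for i j
    by (simp add: mir.new_bot_def new_top_def mcreated neg_lab)
  let ?M = "{e<..<e'}"
  define X where "X = card (exposing e e')"
  define X' where "X' = card (mir.exposing (- e') (- e))"
  have fM: "finite ?M" by simp
  have 1: "(\<Sum>j\<in>?M. card {i. (i, j) \<in> new_top}) + card {j \<in> ?M. (e, j) \<in> new_bot}
    \<le> (\<Sum>j\<in>?M. min (nat (j - e)) t) + X"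
    unfolding X_def by (rule card_new_top_new_bot_le) (use lab t in auto)
  \<comment> \<open>This is estimate 1 for the reflected intervals, whose extreme labels are
    \<open>- e'\<close> and \<open>- e\<close>.\<close>
  have 2: "(\<Sum>i\<in>?M. card {j. (i, j) \<in> new_bot}) + card {i \<in> ?M. (i, e') \<in> new_top}
    \<le> (\<Sum>i\<in>?M. min (nat (e' - i)) t) + X'"
  proof -
    have inj: "inj_on uminus (A :: int set)" for A by (rule inj_onI) simp
    have img: "{i. P (- i)} = uminus ` {i. P i}" for P :: "int \<Rightarrow> bool"
      by (auto intro: image_eqI[of _ _ "- x" for x])
    have "{p \<in> P. - lab p = j} = {p \<in> P. lab p = - j}" for j by auto
    then have "(\<Sum>j\<in>{- e'<..<- e}. card {i. (i, j) \<in> mir.new_top})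
        + card {j \<in> {- e'<..<- e}. (- e', j) \<in> mir.new_bot}
      \<le> (\<Sum>j\<in>{- e'<..<- e}. min (nat (j - - e')) t) + X'"
      unfolding X'_def by (intro mir.card_new_top_new_bot_le) (use lab t in auto)
    moreover have "(\<Sum>j\<in>{- e'<..<- e}. card {i. (i, j) \<in> mir.new_top}) = (\<Sum>i\<in>?M. card {j. (i, j) \<in> new_bot})"
    proof -
      have "(\<Sum>j\<in>{- e'<..<- e}. card {i. (i, j) \<in> mir.new_top}) = (\<Sum>j\<in>{- e'<..<- e}. card {i. (- j, i) \<in> new_bot})"
        by (simp add: mtop img[of "\<lambda>j. (_, j) \<in> new_bot"] card_image[OF inj])
      also have "\<dots> = (\<Sum>i\<in>?M. card {j. (i, j) \<in> new_bot})"
        by (rule sum.reindex_bij_witness[of _ uminus uminus]) auto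
      finally show ?thesis .
    qed
    moreover have "{j \<in> {- e'<..<- e}. (- e', j) \<in> mir.new_bot} = uminus ` {i \<in> ?M. (i, e') \<in> new_top}"
      by (subst img[symmetric]) (auto simp: mbot)
    then have "card {j \<in> {- e'<..<- e}. (- e', j) \<in> mir.new_bot} = card {i \<in> ?M. (i, e') \<in> new_top}"
      by (simp add: card_image[OF inj])
    moreover have "(\<Sum>j\<in>{- e'<..<- e}. min (nat (j - - e')) t) = (\<Sum>i\<in>?M. min (nat (e' - i)) t)"
      by (rule sum.reindex_bij_witness[of _ uminus uminus]) auto
    ultimately show ?thesis by simp
  qed
  let ?D = "{(i, j) \<in> new_del. (i, j) \<noteq> (e, e') \<and> e \<le> i \<and> j \<le> e'}"
  have 3: "card ?D + X + X' + 1 \<le> card {p \<in> P. lab p \<in> ?M}"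
    using card_new_del_le[OF mid] by (simp add: X_def X'_def)
  have "{p \<in> P. lab p \<in> ?M} = (\<Union>j\<in>?M. {p \<in> P. lab p = j})" by auto
  then have "card {p \<in> P. lab p \<in> ?M} \<le> (\<Sum>j\<in>?M. card {p \<in> P. lab p = j})"
    using card_UN_le[OF fM] by metis
  also have "\<dots> \<le> of_nat (card ?M) * t" using t by (intro sum_bounded_above) simp
  finally have 4: "card {p \<in> P. lab p \<in> ?M} \<le> t * nat (e' - e - 1)" by (simp add: mult.commute diff_diff_eq)
  \<comment> \<open>\<open>A\<close> and \<open>B\<close> hold the pairs created by a start of an
    inner interval, \<open>C\<close> and \<open>C'\<close> those created by a start of an extreme
    interval next to an inner one.\<close>
  define A where "A = (\<Union>j\<in>?M. (\<lambda>i. (i, j)) ` {i. (i, j) \<in> new_top})"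
  define B where "B = (\<Union>i\<in>?M. (\<lambda>j. (i, j)) ` {j. (i, j) \<in> new_bot})"
  define C where "C = (\<lambda>j. (e, j)) ` {j \<in> ?M. (e, j) \<in> new_bot}"
  define C' where "C' = (\<lambda>i. (i, e')) ` {i \<in> ?M. (i, e') \<in> new_top}"
  let ?U = "{(i, j). e \<le> i \<and> i < j \<and> j \<le> e'}"
  have mem: "(i, j) \<in> A \<longleftrightarrow> j \<in> ?M \<and> (i, j) \<in> new_top" "(i, j) \<in> B \<longleftrightarrow> i \<in> ?M \<and> (i, j) \<in> new_bot"
    "(i, j) \<in> C \<longleftrightarrow> i = e \<and> j \<in> ?M \<and> (i, j) \<in> new_bot" "(i, j) \<in> C' \<longleftrightarrow> j = e' \<and> i \<in> ?M \<and> (i, j) \<in> new_top"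
    for i j
    unfolding A_def B_def C_def C'_def by blast+
  have U: "?U \<subseteq> {(e, e')} \<union> A \<union> C \<union> B \<union> C' \<union> ?D"
  proof (rule subrelI)
    fix i j assume "(i, j) \<in> ?U"
    then have ij: "e \<le> i" "i < j" "j \<le> e'" by auto
    obtain s where "seen i j s" using all[OF ij] ..
    then have "(i, j) \<in> new_top \<union> new_bot \<union> new_del" by (rule new_cases[OF ij(2)])
    moreover have "i = e \<or> i \<in> ?M" "j = e' \<or> j \<in> ?M" using ij by auto
    ultimately show "(i, j) \<in> {(e, e')} \<union> A \<union> C \<union> B \<union> C' \<union> ?D"
      using ij by (simp add: mem) blast
  qed
  have fin_new: "finite (new_top \<union> new_bot \<union> new_del)"
  proof (rule finite_subset)
    show "new_top \<union> new_bot \<union> new_del \<subseteq> lab ` P \<times> lab ` P"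
      using seen_labels by (fastforce simp: new_top_def new_bot_def new_del_def created_def)
    show "finite (lab ` P \<times> lab ` P)" using fin by simp
  qed
  have "{(e, e')} \<union> A \<union> C \<union> B \<union> C' \<union> ?D \<subseteq> insert (e, e') (new_top \<union> new_bot \<union> new_del)"
    using mem by auto
  then have "finite ({(e, e')} \<union> A \<union> C \<union> B \<union> C' \<union> ?D)" using fin_new by (meson finite_insert finite_subset)
  then have "card ?U \<le> card ({(e, e')} \<union> A \<union> C \<union> B \<union> C' \<union> ?D)"
    using U by (rule card_mono)
  also have "\<dots> \<le> 1 + card A + card C + card B + card C' + card ?D"
    using card_Un_le[of "{(e, e')} \<union> A \<union> C \<union> B \<union> C'" ?D] card_Un_le[of "{(e, e')} \<union> A \<union> C \<union> B" C']
      card_Un_le[of "{(e, e')} \<union> A \<union> C" B] card_Un_le[of "{(e, e')} \<union> A" C] card_Un_le[of "{(e, e')}" A]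
    by simp
  finally have "card ?U \<le> 1 + card A + card C + card B + card C' + card ?D" .
  moreover have "card A \<le> (\<Sum>j\<in>?M. card {i. (i, j) \<in> new_top})"
    unfolding A_def by (rule order_trans[OF card_UN_le[OF fM]]) (simp add: card_image inj_on_def)
  moreover have "card B \<le> (\<Sum>i\<in>?M. card {j. (i, j) \<in> new_bot})"
    unfolding B_def by (rule order_trans[OF card_UN_le[OF fM]]) (simp add: card_image inj_on_def)
  moreover have "card C = card {j \<in> ?M. (e, j) \<in> new_bot}" "card C' = card {i \<in> ?M. (i, e') \<in> new_top}"
    unfolding C_def C'_def by (simp_all add: card_image inj_on_def)
  ultimately show ?thesis using 1 2 3 4 by linarith
qed

end

section \<open>From bars to intervals\<close>

lemma verts_transitive_tournament: "verts (with_proj (transitive_tournament n)) = {1..n}"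
  by (simp add: transitive_tournament_def)

lemma arc_transitive_tournament: "x \<rightarrow>\<^bsub>with_proj (transitive_tournament n)\<^esub> y \<longleftrightarrow> x \<in> {1..n} \<and> y \<in> {1..n} \<and> x < y"
  by (auto simp: transitive_tournament_def)

section \<open>Visibility as adjacency over a point\<close>

definition over :: "bar set \<Rightarrow> real \<Rightarrow> bar set" where
  "over S x = {p \<in> S. bar_left p < x \<and> x < bar_right p}"

lemma bar_segment_meet:
  assumes "bar_segment p \<inter> bar_segment q = {}" "bar_height p = bar_height q"
    "bar_left p \<le> x" "x \<le> bar_right p" "bar_left q \<le> x" "x \<le> bar_right q"
  shows False
proof -
  have "(x, bar_height p) \<in> bar_segment p \<inter> bar_segment q"
    using assms(2-) by (simp add: bar_segment_def)
  then show False using assms(1) by blast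
qed

text \<open>As \<open>x\<close> is not an endpoint, every bar meeting a narrow strip around
  \<open>x\<close> lies over \<open>x\<close>. A blocking bar at the height of \<open>p\<close> or
  \<open>q\<close> would intersect that bar at \<open>x\<close>, so it would have to lie strictly
  between them.\<close>

lemma bar_sees_if_adjacent:
  assumes fin: "finite S" and disj: "\<forall>p\<in>S. \<forall>q\<in>S. p \<noteq> q \<longrightarrow> bar_segment p \<inter> bar_segment q = {}"
    and x: "x \<notin> bar_left ` S \<union> bar_right ` S"
    and p: "p \<in> over S x" and q: "q \<in> over S x" and pq: "bar_height p < bar_height q"
    and none: "\<forall>z\<in>over S x. \<not> (bar_height p < bar_height z \<and> bar_height z < bar_height q)"
  shows "bar_sees S p q"
proof -
  let ?E = "bar_left ` S \<union> bar_right ` S"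
  obtain d where d: "d > 0" "\<forall>y\<in>?E. y \<noteq> x \<longrightarrow> d \<le> dist x y"
    using finite_set_avoid[of ?E x] fin by auto
  have far: "d \<le> \<bar>x - y\<bar>" if "y \<in> ?E" for y using d(2) that x by (auto simp: dist_real_def)
  have in_over: "z \<in> over S x" if z: "z \<in> S" "bar_left z \<le> x + d / 2" "x - d / 2 \<le> bar_right z" for z
    using far[of "bar_left z"] far[of "bar_right z"] z d(1) by (auto simp: over_def)
  have inside: "bar_left z \<le> x - d / 2" "x + d / 2 \<le> bar_right z" if "z \<in> over S x" for z
    using far[of "bar_left z"] far[of "bar_right z"] that d(1) by (auto simp: over_def)
  have "bar_segment z \<inter> ({x - d / 2..x + d / 2} \<times> {bar_height p..bar_height q}) = {}"
    if z: "z \<in> S - {p, q}" for z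
  proof (rule ccontr)
    assume "\<not> ?thesis"
    then obtain y where y: "bar_left z \<le> y" "y \<le> bar_right z" "x - d / 2 \<le> y" "y \<le> x + d / 2"
      "bar_height p \<le> bar_height z" "bar_height z \<le> bar_height q"
      by (auto simp: bar_segment_def)
    then have zo: "z \<in> over S x" using in_over[of z] z by auto
    have "bar_height w \<noteq> bar_height z" if w: "w \<in> over S x" "w \<noteq> z" for w
      using bar_segment_meet[of w z x] disj w zo by (auto simp: over_def)
    then have "bar_height p \<noteq> bar_height z" "bar_height q \<noteq> bar_height z" using p q z by auto
    then show False using none zo y(5,6) by force
  qed
  then show ?thesis unfolding bar_sees_def using pq d(1) inside[OF p] inside[OF q]
    by (intro conjI exI[of _ "x - d / 2"] exI[of _ "x + d / 2"]) auto
qed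

text \<open>The midpoint of the channel serves as \<open>x\<close>: it is interior, so both bars
  extend strictly past it on either side.\<close>

lemma adjacent_if_bar_sees:
  assumes fin: "finite S" and p: "p \<in> S" and q: "q \<in> S" and sees: "bar_sees S p q"
  obtains x where "p \<in> over S x" "q \<in> over S x"
    "\<forall>z\<in>over S x. \<not> (bar_height p < bar_height z \<and> bar_height z < bar_height q)"
proof -
  obtain a b where ab: "a < b" "{a..b} \<subseteq> {bar_left p..bar_right p}" "{a..b} \<subseteq> {bar_left q..bar_right q}"
    and free: "\<forall>z\<in>S - {p, q}. bar_segment z \<inter> ({a..b} \<times> {bar_height p..bar_height q}) = {}"
    using sees by (auto simp: bar_sees_def)
  define x where "x = (a + b) / 2"
  have x: "a < x" "x < b" using ab(1) by (auto simp: x_def)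
  have "z \<notin> over S x" if "bar_height p < bar_height z" "bar_height z < bar_height q" for z
  proof
    assume z: "z \<in> over S x"
    then have "(x, bar_height z) \<in> bar_segment z \<inter> ({a..b} \<times> {bar_height p..bar_height q})"
      using that x by (auto simp: over_def bar_segment_def)
    moreover have "z \<in> S - {p, q}" using z that by (auto simp: over_def)
    ultimately show False using free by blast
  qed
  moreover have "p \<in> over S x" "q \<in> over S x" using ab x p q by (auto simp: over_def)
  ultimately show thesis using that by blast
qed

section \<open>Generic perturbation of endpoints\<close>

lemma eventually_affine_ne:
  fixes a b :: real
  assumes "a \<noteq> 0 \<or> b \<noteq> 0"
  shows "\<forall>\<^sub>F e in at_right 0. a + e * b \<noteq> 0"
proof (cases "a = 0")
  case True
  have "\<forall>\<^sub>F e :: real in at_right 0. 0 < e" by (simp add: eventually_at_filter)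
  then show ?thesis by eventually_elim (use True assms in simp)
next
  case False
  have "((\<lambda>e. a + e * b) \<longlongrightarrow> a + 0 * b) (at_right 0)" by (intro tendsto_intros)
  then show ?thesis using False tendsto_imp_eventually_ne by fastforce
qed

lemma eventually_affine_pos:
  fixes a b :: real
  assumes "0 < a"
  shows "\<forall>\<^sub>F e in at_right 0. 0 < a + e * b"
proof -
  have "((\<lambda>e. a + e * b) \<longlongrightarrow> a + 0 * b) (at_right 0)" by (intro tendsto_intros)
  then show ?thesis using assms order_tendstoD(1) by fastforce
qed

text \<open>Makes all endpoints distinct, so that the events of the sweep happen one at a time.\<close>

lemma perturb_intervals:
  fixes L R :: "'b \<Rightarrow> real"
  assumes fin: "finite S" "finite T" and LR: "\<forall>p\<in>S. L p < R p"
  obtains l r where "\<forall>p\<in>S. L p < l p \<and> l p < r p \<and> r p < R p" "inj_on l S" "inj_on r S"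
    "\<forall>p\<in>S. \<forall>q\<in>S. l p \<noteq> r q"
    "\<forall>p\<in>S. \<forall>x\<in>T. (L p < x \<longrightarrow> l p < x) \<and> (x < R p \<longrightarrow> x < r p)"
proof -
  obtain idx :: "'b \<Rightarrow> nat" where idx: "inj_on idx S"
    using finite_imp_inj_to_nat_seg[OF fin(1)] by blast
  \<comment> \<open>Both ends of \<open>p\<close> move inwards by \<open>e * k p\<close>. The
    \<open>k p\<close> are positive and pairwise distinct, so each possible coincidence of two
    endpoints occurs for at most one \<open>e\<close>.\<close>
  define k where "k p = real (Suc (idx p))" for p
  have kpos: "k p > 0" for p by (simp add: k_def)
  have kinj: "k p \<noteq> k q" if "p \<in> S" "q \<in> S" "p \<noteq> q" for p q
    using idx that by (auto simp: k_def inj_on_def)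
  have "\<forall>\<^sub>F e in at_right 0. \<forall>p\<in>S. 0 < (R p - L p) + e * (- 2 * k p)"
    using LR by (intro eventually_ball_finite ballI fin eventually_affine_pos) simp
  moreover have "\<forall>\<^sub>F e in at_right 0. \<forall>p\<in>S. \<forall>q\<in>S - {p}. (L p - L q) + e * (k p - k q) \<noteq> 0"
    using kinj by (intro eventually_ball_finite ballI finite_Diff fin eventually_affine_ne) auto
  moreover have "\<forall>\<^sub>F e in at_right 0. \<forall>p\<in>S. \<forall>q\<in>S - {p}. (R p - R q) + e * (k q - k p) \<noteq> 0"
    using kinj by (intro eventually_ball_finite ballI finite_Diff fin eventually_affine_ne) auto
  moreover have "\<forall>\<^sub>F e in at_right 0. \<forall>p\<in>S. \<forall>q\<in>S. (L p - R q) + e * (k p + k q) \<noteq> 0"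
    using kpos by (intro eventually_ball_finite ballI fin eventually_affine_ne) (smt (verit))
  \<comment> \<open>This condition and the next keep points of \<open>T\<close> that lie inside an
    interval inside the shrunken one.\<close>
  moreover have "\<forall>\<^sub>F e in at_right 0. \<forall>p\<in>S. \<forall>x\<in>{x \<in> T. L p < x}. 0 < (x - L p) + e * (- k p)"
    by (intro eventually_ball_finite ballI fin eventually_affine_pos) (use fin in auto)
  moreover have "\<forall>\<^sub>F e in at_right 0. \<forall>p\<in>S. \<forall>x\<in>{x \<in> T. x < R p}. 0 < (R p - x) + e * (- k p)"
    by (intro eventually_ball_finite ballI fin eventually_affine_pos) (use fin in auto)
  moreover have "\<forall>\<^sub>F e :: real in at_right 0. 0 < e" by (simp add: eventually_at_filter)
  ultimately have "\<forall>\<^sub>F e in at_right 0. 0 < e \<and> (\<forall>p\<in>S. 0 < (R p - L p) + e * (- 2 * k p)) \<and>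
      (\<forall>p\<in>S. \<forall>q\<in>S - {p}. (L p - L q) + e * (k p - k q) \<noteq> 0) \<and>
      (\<forall>p\<in>S. \<forall>q\<in>S - {p}. (R p - R q) + e * (k q - k p) \<noteq> 0) \<and>
      (\<forall>p\<in>S. \<forall>q\<in>S. (L p - R q) + e * (k p + k q) \<noteq> 0) \<and>
      (\<forall>p\<in>S. \<forall>x\<in>{x \<in> T. L p < x}. 0 < (x - L p) + e * (- k p)) \<and>
      (\<forall>p\<in>S. \<forall>x\<in>{x \<in> T. x < R p}. 0 < (R p - x) + e * (- k p))"
    by eventually_elim blast
  then obtain e where e: "0 < e" "\<And>p. p \<in> S \<Longrightarrow> 0 < (R p - L p) + e * (- 2 * k p)"
    "\<And>p q. \<lbrakk>p \<in> S; q \<in> S; q \<noteq> p\<rbrakk> \<Longrightarrow> (L p - L q) + e * (k p - k q) \<noteq> 0"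
    "\<And>p q. \<lbrakk>p \<in> S; q \<in> S; q \<noteq> p\<rbrakk> \<Longrightarrow> (R p - R q) + e * (k q - k p) \<noteq> 0"
    "\<And>p q. \<lbrakk>p \<in> S; q \<in> S\<rbrakk> \<Longrightarrow> (L p - R q) + e * (k p + k q) \<noteq> 0"
    "\<And>p x. \<lbrakk>p \<in> S; x \<in> T; L p < x\<rbrakk> \<Longrightarrow> 0 < (x - L p) + e * (- k p)"
    "\<And>p x. \<lbrakk>p \<in> S; x \<in> T; x < R p\<rbrakk> \<Longrightarrow> 0 < (R p - x) + e * (- k p)"
    by (auto dest!: eventually_happens)
  have ek: "0 < e * k p" for p using e(1) kpos by simp
  show thesis
  proof (rule that[of "\<lambda>p. L p + e * k p" "\<lambda>p. R p - e * k p"])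
    show "\<forall>p\<in>S. L p < L p + e * k p \<and> L p + e * k p < R p - e * k p \<and> R p - e * k p < R p"
      using ek e(2) by (auto simp: algebra_simps)
    show "inj_on (\<lambda>p. L p + e * k p) S"
      by (rule inj_onI, rule ccontr) (use e(3) in \<open>fastforce simp: algebra_simps\<close>)
    show "inj_on (\<lambda>p. R p - e * k p) S"
      by (rule inj_onI, rule ccontr) (use e(4) in \<open>fastforce simp: algebra_simps\<close>)
    show "\<forall>p\<in>S. \<forall>q\<in>S. L p + e * k p \<noteq> R q - e * k q"
      using e(5) by (fastforce simp: algebra_simps)
    show "\<forall>p\<in>S. \<forall>x\<in>T. (L p < x \<longrightarrow> L p + e * k p < x) \<and> (x < R p \<longrightarrow> x < R p - e * k p)"
      using e(6,7) by (fastforce simp: algebra_simps)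
  qed
qed

text \<open>Neighbours in height over \<open>x\<close> see each other, so labels grow from one to
  the next; the induction splits at a bar in between.\<close>

lemma over_lab_mono:
  assumes fin: "finite S" and disj: "\<forall>p\<in>S. \<forall>q\<in>S. p \<noteq> q \<longrightarrow> bar_segment p \<inter> bar_segment q = {}"
    and x: "x \<notin> bar_left ` S \<union> bar_right ` S"
    and sees: "\<And>p q. \<lbrakk>p \<in> S; q \<in> S; bar_sees S p q\<rbrakk> \<Longrightarrow> lab p \<le> (lab q :: int)"
    and pq: "p \<in> over S x" "q \<in> over S x" "bar_height p < bar_height q"
  shows "lab p \<le> lab q"
  using pq
proof (induction "card {z \<in> over S x. bar_height p < bar_height z \<and> bar_height z < bar_height q}"
    arbitrary: p q rule: less_induct)
  case less
  let ?B = "\<lambda>p q. {z \<in> over S x. bar_height p < bar_height z \<and> bar_height z < bar_height q}"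
  have fB: "finite (?B u v)" for u v using fin by (simp add: over_def)
  show ?case
  proof (cases "?B p q = {}")
    case True
    then have "bar_sees S p q" using less.prems by (intro bar_sees_if_adjacent[OF fin disj x]) blast+
    then show ?thesis using sees less.prems by (simp add: over_def)
  next
    case False
    then obtain z where z: "z \<in> over S x" "bar_height p < bar_height z" "bar_height z < bar_height q" by blast
    have "?B p z \<subset> ?B p q" "?B z q \<subset> ?B p q" using z by force+
    then have "lab p \<le> lab z" "lab z \<le> lab q"
      using z less.prems by (auto intro!: less.hyps psubset_card_mono fB)
    then show ?thesis by simp
  qed
qed

text \<open>This applies \<open>count_pairs\<close> to the bars with perturbed endpoints, vertex
  indices as labels and extreme labels 1 and \<open>n\<close>.\<close>

lemma rep_pairs_le:
  assumes rep: "bar_visibility_rep t (with_proj (transitive_tournament n)) f" and n: "n \<ge> 3"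
  shows "card {(i, j). 1 \<le> i \<and> i < j \<and> j \<le> int n} \<le> (\<Sum>j\<in>{1<..<int n}. min (nat (j - 1)) t)
    + (\<Sum>j\<in>{1<..<int n}. min (nat (int n - j)) t) + t * nat (int n - 1 - 1)"
proof -
  define S where "S = (\<Union>z\<in>{1..n}. f z)"
  note rep' = rep[unfolded bar_visibility_rep_def verts_transitive_tournament arc_transitive_tournament, folded S_def]
  have f: "finite (f x)" "card (f x) \<le> t" "\<And>p. p \<in> f x \<Longrightarrow> bar_left p < bar_right p" if "x \<in> {1..n}" for x
    using rep' that by blast+
  have dj: "bar_segment p \<inter> bar_segment q = {}"
    if "x \<in> {1..n}" "y \<in> {1..n}" "p \<in> f x" "q \<in> f y" "(x, p) \<noteq> (y, q)" for x y p q
    using rep' that by blast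
  have arcs: "x < y \<longleftrightarrow> (\<exists>p\<in>f x. \<exists>q\<in>f y. bar_sees S p q)" if "x \<in> {1..n}" "y \<in> {1..n}" "x \<noteq> y" for x y
    using rep' that by blast
  have finS: "finite S" using f by (auto simp: S_def)
  have LR: "\<forall>p\<in>S. bar_left p < bar_right p" using f by (auto simp: S_def)
  have disj: "\<forall>p\<in>S. \<forall>q\<in>S. p \<noteq> q \<longrightarrow> bar_segment p \<inter> bar_segment q = {}"
    using dj unfolding S_def by blast
  \<comment> \<open>A bar shared by two vertices would have to be disjoint from itself.\<close>
  have owner: "x = y" if "x \<in> {1..n}" "y \<in> {1..n}" "p \<in> f x" "p \<in> f y" for x y p
  proof (rule ccontr)
    assume "x \<noteq> y"
    then have "bar_segment p \<inter> bar_segment p = {}" using dj[of x y p p] that by blast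
    then show False using f(3)[OF that(1,3)] bar_segment_meet[of p p "bar_left p"] by simp
  qed
  define lab where "lab p = int (THE x. x \<in> {1..n} \<and> p \<in> f x)" for p
  have lab: "lab p = int x" if "x \<in> {1..n}" "p \<in> f x" for x p
  proof -
    have "(THE x. x \<in> {1..n} \<and> p \<in> f x) = x" using that owner by blast
    then show ?thesis by (simp add: lab_def)
  qed
  have sees_lab: "lab p \<le> lab q" if pq: "p \<in> S" "q \<in> S" "bar_sees S p q" for p q
  proof -
    obtain x y where x: "x \<in> {1..n}" "p \<in> f x" and y: "y \<in> {1..n}" "q \<in> f y" using pq unfolding S_def by blast
    then have "x \<le> y" using arcs[of x y] pq(3) by (cases "x = y") auto
    then show ?thesis using lab[OF x] lab[OF y] by simp
  qed
  have "\<exists>p q x. p \<in> f i \<and> q \<in> f j \<and> bar_height p < bar_height q \<and> p \<in> over S x \<and> q \<in> over S x \<and>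
      (\<forall>z\<in>over S x. \<not> (bar_height p < bar_height z \<and> bar_height z < bar_height q))"
    if ij: "1 \<le> i" "i < j" "j \<le> n" for i j
  proof -
    obtain p q where pq: "p \<in> f i" "q \<in> f j" "bar_sees S p q" using arcs[of i j] ij by auto
    then have "p \<in> S" "q \<in> S" using ij by (auto simp: S_def)
    then obtain x where "p \<in> over S x" "q \<in> over S x"
      "\<forall>z\<in>over S x. \<not> (bar_height p < bar_height z \<and> bar_height z < bar_height q)"
      using adjacent_if_bar_sees[OF finS _ _ pq(3)] by blast
    moreover have "bar_height p < bar_height q" using pq(3) by (simp add: bar_sees_def)
    ultimately show ?thesis using pq by blast
  qed
  then obtain p q x where pqx: "\<And>i j. \<lbrakk>1 \<le> i; i < j; j \<le> n\<rbrakk> \<Longrightarrow>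
      p i j \<in> f i \<and> q i j \<in> f j \<and> bar_height (p i j) < bar_height (q i j) \<and>
      p i j \<in> over S (x i j) \<and> q i j \<in> over S (x i j) \<and>
      (\<forall>z\<in>over S (x i j). \<not> (bar_height (p i j) < bar_height z \<and> bar_height z < bar_height (q i j)))"
    by metis
  \<comment> \<open>\<open>T\<close> contains, for each arc, a point over which two adjacent bars
    witness it.\<close>
  define T where "T = (\<lambda>(i, j). x i j) ` ({1..n} \<times> {1..n})"
  have finT: "finite T" by (simp add: T_def)
  obtain l r where lr: "\<forall>p\<in>S. bar_left p < l p \<and> l p < r p \<and> r p < bar_right p" "inj_on l S" "inj_on r S"
    "\<forall>p\<in>S. \<forall>q\<in>S. l p \<noteq> r q"
    "\<forall>p\<in>S. \<forall>x\<in>T. (bar_left p < x \<longrightarrow> l p < x) \<and> (x < bar_right p \<longrightarrow> x < r p)"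
    using perturb_intervals[OF finS finT LR] .
  interpret sweep S l r bar_height lab
  proof
    show "finite S" by (rule finS)
  next
    fix p q assume pq: "p \<in> S" "q \<in> S" "l p < r q" "l q < r p"
    define a where "a = max (l p) (l q)"
    define b where "b = min (r p) (r q)"
    \<comment> \<open>The overlap contains a point that is no original endpoint; there disjointness
      of the bars and \<open>over_lab_mono\<close> apply.\<close>
    have "a < b" using pq lr(1) by (auto simp: a_def b_def)
    then have "infinite ({a<..<b} - (bar_left ` S \<union> bar_right ` S))"
      using finS by (intro Diff_infinite_finite) auto
    then obtain y where y: "y \<in> {a<..<b}" "y \<notin> bar_left ` S \<union> bar_right ` S"
      by (metis Diff_iff ex_in_conv finite.emptyI)
    have "l p < y" "l q < y" "y < r p" "y < r q" using y(1) by (auto simp: a_def b_def)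
    then have o: "p \<in> over S y" "q \<in> over S y" using lr(1) pq(1,2) by (force simp: over_def)+
    show "p = q" if "bar_height p = bar_height q"
      using disj pq(1,2) bar_segment_meet[of p q y] that o by (auto simp: over_def)
    show "lab p \<le> lab q" if "bar_height p < bar_height q"
      using over_lab_mono[OF finS disj y(2) sees_lab o that] .
  qed (use lr in \<open>auto dest: inj_onD\<close>)
  \<comment> \<open>At the witness points the perturbation changes nothing, so adjacency of bars
    carries over to the sweep.\<close>
  have act_T: "act y = over S y" if "y \<in> T" for y
    using that lr(1,5) by (force simp: act_def over_def)
  show ?thesis
  proof (rule count_pairs)
    show "\<forall>p\<in>S. lab p \<in> {1..int n}" using lab by (auto simp: S_def)
    show "\<forall>j. card {p \<in> S. lab p = j} \<le> t"
    proof
      fix j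
      show "card {p \<in> S. lab p = j} \<le> t"
      proof (cases "j \<in> {1..int n}")
        case True
        then have "nat j \<in> {1..n}" by auto
        moreover have "{p \<in> S. lab p = j} \<subseteq> f (nat j)" using lab by (auto simp: S_def)
        ultimately show ?thesis using f card_mono le_trans by blast
      next
        case False
        then have "{p \<in> S. lab p = j} = {}" using lab by (auto simp: S_def)
        then show ?thesis by (simp only: card.empty le0)
      qed
    qed
    \<comment> \<open>Vertex 2 is inner because \<open>n \<ge> 3\<close>, and the arc from 2 to 3
      provides a bar for it.\<close>
    have "p 2 3 \<in> f 2" using pqx[of 2 3] n by simp
    then have "p 2 3 \<in> S" "lab (p 2 3) = 2" using n lab[of 2] by (auto simp: S_def)
    then show "\<exists>p\<in>S. lab p \<in> {1<..<int n}" using n by (intro bexI[of _ "p 2 3"]) auto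
  next
    fix i j assume ij: "1 \<le> i" "i < j" "j \<le> int n"
    define i' j' where "i' = nat i" and "j' = nat j"
    have ij': "1 \<le> i'" "i' < j'" "j' \<le> n" "i' \<in> {1..n}" "j' \<in> {1..n}" "int i' = i" "int j' = j"
      using ij by (auto simp: i'_def j'_def)
    note * = pqx[OF ij'(1-3)]
    have "x i' j' \<in> T" using ij'(4,5) by (auto simp: T_def)
    then have "adj (act (x i' j')) (p i' j') (q i' j')" using * by (auto simp: adj_def act_T)
    moreover have "lab (p i' j') = i" "lab (q i' j') = j" using lab ij'(4-7) * by auto
    ultimately show "\<exists>s. seen i j s" by (auto simp: seen_def)
  qed
qed

section \<open>Existence of a representation\<close>

text \<open>Each arc gets a column of its own, addressed by the code of the pair; the factor 2
  separates unit-width columns. Height 0 will hold the tail and height 1 the head.\<close>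

definition stacked_bar :: "nat \<times> nat \<Rightarrow> real \<Rightarrow> bar" where
  "stacked_bar e h = Bar (2 * real (prod_encode e)) (2 * real (prod_encode e) + 1) h"

lemma stacked_bar_overlap:
  assumes "2 * real (prod_encode e) \<le> x" "x \<le> 2 * real (prod_encode e) + 1"
    "2 * real (prod_encode e') \<le> x" "x \<le> 2 * real (prod_encode e') + 1"
  shows "e = e'"
proof -
  have "prod_encode e = prod_encode e'" using assms by linarith
  then show ?thesis by (simp add: prod_encode_eq)
qed

definition stacked_bars :: "nat \<Rightarrow> nat \<Rightarrow> bar set" where
  "stacked_bars n x = (\<lambda>j. stacked_bar (x, j) 0) ` {x<..n} \<union> (\<lambda>i. stacked_bar (i, x) 1) ` {1..<x}"

lemma stacked_bars_cases:
  assumes "p \<in> stacked_bars n x"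
  obtains e h where "p = stacked_bar e h" "h = 0 \<and> fst e = x \<or> h = 1 \<and> snd e = x"
  using assms unfolding stacked_bars_def
proof (elim UnE imageE)
  fix j assume "p = stacked_bar (x, j) 0"
  then show thesis using that[of "(x, j)" 0] by simp
next
  fix i assume "p = stacked_bar (i, x) 1"
  then show thesis using that[of "(i, x)" 1] by simp
qed

text \<open>A channel lies in a single column, and the column of an arc contains only the two bars
  of that arc.\<close>

lemma stacked_bars_sees:
  assumes S: "S = (\<Union>x\<in>{1..n}. stacked_bars n x)" and xy: "x \<in> {1..n}" "y \<in> {1..n}"
  shows "x < y \<longleftrightarrow> (\<exists>p\<in>stacked_bars n x. \<exists>q\<in>stacked_bars n y. bar_sees S p q)"
proof
  assume "x < y"
  let ?a = "2 * real (prod_encode (x, y))"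
  let ?p = "stacked_bar (x, y) 0" and ?q = "stacked_bar (x, y) 1"
  have "?p \<in> stacked_bars n x" "?q \<in> stacked_bars n y"
    using \<open>x < y\<close> xy by (auto simp: stacked_bars_def)
  moreover have "bar_segment z \<inter> ({?a..?a + 1} \<times> {0..1}) = {}" if z: "z \<in> S - {?p, ?q}" for z
  proof (rule ccontr)
    assume "\<not> ?thesis"
    moreover obtain e h where e: "z = stacked_bar e h" "h = 0 \<or> h = 1"
      using z by (auto simp: S stacked_bars_def)
    ultimately have "e = (x, y)"
      using stacked_bar_overlap[of e _ "(x, y)"] by (auto simp: stacked_bar_def bar_segment_def)
    then show False using e z by auto
  qed
  then have "bar_sees S ?p ?q" unfolding bar_sees_def
    by (intro conjI exI[of _ ?a] exI[of _ "?a + 1"]) (auto simp: stacked_bar_def)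
  ultimately show "\<exists>p\<in>stacked_bars n x. \<exists>q\<in>stacked_bars n y. bar_sees S p q" by blast
next
  assume "\<exists>p\<in>stacked_bars n x. \<exists>q\<in>stacked_bars n y. bar_sees S p q"
  then obtain p q a b where p: "p \<in> stacked_bars n x" and q: "q \<in> stacked_bars n y"
    and h: "bar_height p < bar_height q" and ab: "a < b" "{a..b} \<subseteq> {bar_left p..bar_right p}"
      "{a..b} \<subseteq> {bar_left q..bar_right q}"
    by (auto simp: bar_sees_def)
  obtain j where j: "p = stacked_bar (x, j) 0" "x < j" using p q h by (auto simp: stacked_bars_def stacked_bar_def)
  obtain i where i: "q = stacked_bar (i, y) 1" "i < y" using p q h by (auto simp: stacked_bars_def stacked_bar_def)
  have "(x, j) = (i, y)"
    by (rule stacked_bar_overlap[of _ a]) (use ab i(1) j(1) in \<open>auto simp: stacked_bar_def\<close>)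
  then show "x < y" using j by simp
qed

text \<open>Ensures that the \<open>LEAST\<close> in the bar visibility number is attained by an
  actual representation.\<close>

lemma ex_bar_visibility_rep: "\<exists>t f. bar_visibility_rep t (with_proj (transitive_tournament n)) f"
proof -
  let ?t = "\<Sum>x\<in>{1..n}. card (stacked_bars n x)"
  have "finite (stacked_bars n x) \<and> card (stacked_bars n x) \<le> ?t \<and> (\<forall>p\<in>stacked_bars n x. bar_left p < bar_right p)"
    if "x \<in> {1..n}" for x
    using member_le_sum[of x "{1..n}" "\<lambda>x. card (stacked_bars n x)"] that
    by (auto simp: stacked_bars_def stacked_bar_def)
  moreover have "bar_segment p \<inter> bar_segment q = {}"
    if "p \<in> stacked_bars n x" "q \<in> stacked_bars n y" "(x, p) \<noteq> (y, q)" for x y p q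
  proof (rule ccontr)
    assume meet: "\<not> ?thesis"
    obtain e h where e: "p = stacked_bar e h" "h = 0 \<and> fst e = x \<or> h = 1 \<and> snd e = x"
      by (rule stacked_bars_cases[OF \<open>p \<in> stacked_bars n x\<close>])
    obtain e' h' where e': "q = stacked_bar e' h'" "h' = 0 \<and> fst e' = y \<or> h' = 1 \<and> snd e' = y"
      by (rule stacked_bars_cases[OF \<open>q \<in> stacked_bars n y\<close>])
    have "h = h'" "e = e'"
      using meet stacked_bar_overlap[of e _ e'] by (auto simp: e(1) e'(1) stacked_bar_def bar_segment_def)
    then show False using e e' that(3) by auto
  qed
  ultimately have "bar_visibility_rep ?t (with_proj (transitive_tournament n)) (stacked_bars n)"
    unfolding bar_visibility_rep_def verts_transitive_tournament arc_transitive_tournament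
    using stacked_bars_sees[OF refl, of _ n] by blast
  then show ?thesis by blast
qed

section \<open>The lower bound\<close>

text \<open>The terms below \<open>t\<close> fall short of \<open>t\<close> by
  \<open>t * (t - 1) / 2\<close> in total. Doubling avoids the division, and integers avoid
  truncated subtraction.\<close>

lemma sum_min:
  fixes m t :: nat
  assumes "t \<le> m + 1"
  shows "2 * int (\<Sum>k=1..m. min k t) = 2 * int t * int m - int t * (int t - 1)"
  using assms
proof (induction m)
  case 0
  then have "t = 0 \<or> t = 1" by auto
  then show ?case by auto
next
  case (Suc m)
  show ?case
  proof (cases "t = Suc m + 1")
    \<comment> \<open>The boundary value lies outside the induction hypothesis; here every minimum
      is \<open>k\<close>.\<close>
    case True
    then have "(\<Sum>k=1..Suc m. min k t) = \<Sum>{1..Suc m}" by (intro sum.cong) auto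
    also have "2 * int \<dots> = int (Suc m) * (int (Suc m) + 1)"
      using double_gauss_sum_from_Suc_0[of "Suc m", where 'a = int] by simp
    finally show ?thesis using True by (simp add: algebra_simps)
  next
    case False
    then show ?thesis using Suc by (simp add: algebra_simps)
  qed
qed

lemma card_pairs: "2 * int (card {(i, j). (1 :: int) \<le> i \<and> i < j \<and> j \<le> int n}) = int n * (int n - 1)"
proof -
  have eq: "{(i, j). (1 :: int) \<le> i \<and> i < j \<and> j \<le> int n} = prod.swap ` (SIGMA j:{1..int n}. {1..<j})"
    by (auto simp: image_iff)
  have "card {(i, j). (1 :: int) \<le> i \<and> i < j \<and> j \<le> int n} = (\<Sum>j\<in>{1..int n}. nat (j - 1))"
    unfolding eq by (subst card_image) (auto simp: card_SigmaI inj_on_def)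
  also have "\<dots> = \<Sum>{..<n}"
    by (rule sum.reindex_bij_witness[of _ "\<lambda>k. int k + 1" "\<lambda>j. nat (j - 1)"]) auto
  also have "2 * int (\<Sum>{..<n}) = int n * (int n - 1)"
    by (induction n) (auto simp: algebra_simps)
  finally show ?thesis .
qed

text \<open>Completing the square turns the quadratic inequality into \<open>(3 * x - 5 - 2 *
  t)\<^sup>2 \<le> 7 * x\<^sup>2 - 28 * x + 25\<close>. For \<open>t > x - 1\<close> the bound
  follows from the size of the radicand alone.\<close>

lemma root_bound:
  fixes x t :: real
  assumes n: "3 \<le> x" and t: "t \<le> x - 1 \<Longrightarrow> x * (x - 1) \<le> 2 * (t * (3 * x - t - 5))"
  shows "(3 * x - 5 - sqrt (7 * x\<^sup>2 - 28 * x + 25)) / 2 \<le> t"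
proof -
  have "3 * x - 5 - 2 * t \<le> sqrt (7 * x\<^sup>2 - 28 * x + 25)"
  proof (cases "t \<le> x - 1")
    case True
    have "(3 * x - 5 - 2 * t)\<^sup>2 \<le> 7 * x\<^sup>2 - 28 * x + 25"
      using t[OF True] by (simp add: power2_eq_square algebra_simps)
    then show ?thesis by (rule real_le_rsqrt)
  next
    case False
    \<comment> \<open>This product is the radicand minus \<open>(x - 3)\<^sup>2\<close>, and
      \<open>x - 3\<close> exceeds \<open>3 * x - 5 - 2 * t\<close> in this case.\<close>
    have "0 \<le> (6 * x - 16) * (x - 1)" using n by (intro mult_nonneg_nonneg) auto
    then have "(x - 3)\<^sup>2 \<le> 7 * x\<^sup>2 - 28 * x + 25" by (simp add: power2_eq_square algebra_simps)
    then have "x - 3 \<le> sqrt (7 * x\<^sup>2 - 28 * x + 25)" by (rule real_le_rsqrt)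
    then show ?thesis using False by simp
  qed
  then show ?thesis by simp
qed

text \<open>The radicand equals \<open>7 * (x - 2)\<^sup>2 - 3\<close>.\<close>

lemma root_bound_gt_linear:
  fixes x :: real
  assumes "3 \<le> x"
  shows "(3 - sqrt 7) / 2 * x + sqrt 7 - 5 / 2 < (3 * x - 5 - sqrt (7 * x\<^sup>2 - 28 * x + 25)) / 2"
proof -
  have "sqrt (7 * x\<^sup>2 - 28 * x + 25) < sqrt (7 * (x - 2)\<^sup>2)"
    by (rule real_sqrt_less_mono) (simp add: power2_eq_square algebra_simps)
  also have "\<dots> = sqrt 7 * (x - 2)" using assms by (simp add: real_sqrt_mult)
  finally show ?thesis by (simp add: field_simps)
qed

lemma sqrt_7_approx: "\<bar>(3 - sqrt 7) / 2 - 0.177124\<bar> < 5 / 10 ^ 7"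
proof -
  have "2.645751 < sqrt 7" by (rule real_less_rsqrt) (simp add: power2_eq_square)
  moreover have "sqrt 7 < 2.645752" by (rule real_less_lsqrt) (simp_all add: power2_eq_square)
  ultimately show ?thesis by simp
qed

lemma bar_visibility_number_ge:
  assumes n: "n \<ge> 3"
  shows "(3 * real n - 5 - sqrt (7 * (real n)\<^sup>2 - 28 * real n + 25)) / 2
    \<le> real (bar_visibility_number (with_proj (transitive_tournament n)))"
proof (rule root_bound)
  let ?t = "bar_visibility_number (with_proj (transitive_tournament n))"
  show "3 \<le> real n" using n by simp
  assume "real ?t \<le> real n - 1"
  \<comment> \<open>There are \<open>n - 2\<close> inner vertices, so this is the hypothesis of
    \<open>sum_min\<close> for the sums below.\<close>
  then have t: "?t \<le> n - 2 + 1" using n by linarith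
  obtain f where "bar_visibility_rep ?t (with_proj (transitive_tournament n)) f"
    using LeastI_ex[OF ex_bar_visibility_rep] unfolding bar_visibility_number_def by blast
  note le = rep_pairs_le[OF this n]
  \<comment> \<open>Indexing by the distance to the extreme vertex makes both sums equal.\<close>
  have 1: "(\<Sum>j\<in>{1<..<int n}. min (nat (j - 1)) ?t) = (\<Sum>k=1..n - 2. min k ?t)"
    by (rule sum.reindex_bij_witness[of _ "\<lambda>k. int k + 1" "\<lambda>j. nat (j - 1)"]) auto
  have 2: "(\<Sum>j\<in>{1<..<int n}. min (nat (int n - j)) ?t) = (\<Sum>k=1..n - 2. min k ?t)"
    by (rule sum.reindex_bij_witness[of _ "\<lambda>k. int n - int k" "\<lambda>j. nat (int n - j)"]) auto
  have n2: "nat (int n - 1 - 1) = n - 2" by simp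
  have "int n * (int n - 1) \<le> 2 * (2 * int (\<Sum>k=1..n - 2. min k ?t)) + 2 * (int ?t * int (n - 2))"
    using le[unfolded 1 2 n2, THEN zle_int[THEN iffD2]] unfolding card_pairs[symmetric]
    unfolding of_nat_add of_nat_mult by linarith
  also have "\<dots> = 2 * (2 * int ?t * int (n - 2) - int ?t * (int ?t - 1)) + 2 * (int ?t * int (n - 2))"
    using sum_min[OF t] by simp
  also have "\<dots> = 2 * (int ?t * (3 * int n - int ?t - 5))"
    using n by (simp add: of_nat_diff algebra_simps)
  finally have "real_of_int (int n * (int n - 1)) \<le> real_of_int (2 * (int ?t * (3 * int n - int ?t - 5)))"
    by (simp only: of_int_le_iff)
  then show "real n * (real n - 1) \<le> 2 * (real ?t * (3 * real n - real ?t - 5))" by simp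
qed

text \<open>Divided by \<open>n\<close>, the linear lower bound differs from
  \<open>(3 - sqrt 7) / 2\<close> by a multiple of \<open>1 / n\<close>, and weak inequalities pass
  to the limit.\<close>

lemma bar_visibility_number_limit_ge:
  assumes lim: "(\<lambda>n. real (bar_visibility_number (with_proj (transitive_tournament n))) / real n) \<longlonglongrightarrow> L"
  shows "(3 - sqrt 7) / 2 \<le> L"
proof (rule LIMSEQ_le[OF _ lim])
  show "(\<lambda>n. (3 - sqrt 7) / 2 + (sqrt 7 - 5 / 2) / real n) \<longlonglongrightarrow> (3 - sqrt 7) / 2"
    using tendsto_add[OF tendsto_const lim_const_over_n] by fastforce
  show "\<exists>N. \<forall>n\<ge>N. (3 - sqrt 7) / 2 + (sqrt 7 - 5 / 2) / real n
      \<le> real (bar_visibility_number (with_proj (transitive_tournament n))) / real n"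
  proof (intro exI[of _ 3] allI impI)
    fix n :: nat assume n: "3 \<le> n"
    have "(3 - sqrt 7) / 2 * real n + sqrt 7 - 5 / 2 \<le> real (bar_visibility_number (with_proj (transitive_tournament n)))"
      using bar_visibility_number_ge[OF n] root_bound_gt_linear[of "real n"] n by linarith
    then have "((3 - sqrt 7) / 2 * real n + (sqrt 7 - 5 / 2)) / real n
        \<le> real (bar_visibility_number (with_proj (transitive_tournament n))) / real n"
      by (intro divide_right_mono) simp_all
    then show "(3 - sqrt 7) / 2 + (sqrt 7 - 5 / 2) / real n
        \<le> real (bar_visibility_number (with_proj (transitive_tournament n))) / real n"
      using n by (simp add: add_divide_distrib)
  qed
qed

theorem theorem3p5:
  shows "(\<forall>n::nat. n \<ge> 3 \<longrightarrow>
            real (bar_visibility_number (with_proj (transitive_tournament n)))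
              \<ge> (3 * real n - 5 - sqrt (7 * (real n)\<^sup>2 - 28 * real n + 25)) / 2 \<and>
            (3 * real n - 5 - sqrt (7 * (real n)\<^sup>2 - 28 * real n + 25)) / 2
              > (3 - sqrt 7) / 2 * real n + sqrt 7 - 5 / 2) \<and>
         (\<forall>L::real. (\<lambda>n. real (bar_visibility_number (with_proj (transitive_tournament n))) / real n) \<longlonglongrightarrow> L
            \<longrightarrow> L \<ge> (3 - sqrt 7) / 2) \<and>
         \<bar>(3 - sqrt 7) / 2 - 0.177124\<bar> < 5 / 10 ^ 7"
  using bar_visibility_number_ge root_bound_gt_linear bar_visibility_number_limit_ge sqrt_7_approx by simp

end
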